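(* Let $A\in\mathbb{R}^{m\times n}$ have nonnegative entries and let $y\in\mathbb{R}^m_{\ge 0}$. Assume that every row and every column of $A$ contains at least one strictly positive entry, and that $A^\top y>0$ (componentwise). Define $g:\mathbb{R}^n\to\mathbb{R}$ by $g(\theta)=\mathrm{KL}(y,Ae^{\theta})$ and $\mathcal{A}:\mathbb{R}^n\to\mathbb{R}$ by $\mathcal{A}(\theta)=\sum_{i=1}^m\sum_{j=1}^n A_{ij}e^{\theta_j}$. Then the mirror descent update applied to $g$ with mirror potential $\mathcal{A}$ (and unit step size), $$\theta^{(r+1)}=(\nabla\mathcal{A})^{-1}\bigl(\nabla\mathcal{A}(\theta^{(r)})-\nabla g(\theta^{(r)})\bigr),$$ is equivalent to the classical EMML iteration up to the reparametrization $x^{(r)}=\exp(\theta^{(r)})$. That is, the update is well defined for every $\theta^{(r)}\in\mathbb{R}^n$, and a sequence $(\theta^{(r)})_{r\in\mathbb{N}}$ in $\mathbb{R}^n$ satisfies it for all $r$ if and only if the sequence $x^{(r)}=\exp(\theta^{(r)})$ satisfies, for all $r$, $$x^{(r+1)}=x^{(r)}\odot\frac{A^\top\frac{y}{Ax^{(r)}}}{A^\top\mathbf{1}}.$$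
   Context: Exponentials, logarithms and divisions of vectors are componentwise, $\odot$ is the componentwise product, and $\mathbf{1}$ is the all-ones vector in $\mathbb{R}^m$. For $u\in\mathbb{R}^m_{\ge0}$, $v\in\mathbb{R}^m_{>0}$, the generalized Kullback–Leibler divergence is $\mathrm{KL}(u,v)=\sum_{i=1}^m\bigl[u_i\log\frac{u_i}{v_i}+v_i-u_i\bigr]$, with $0\log 0=0$. Under the column assumption, $\nabla\mathcal{A}$ is a bijection from $\mathbb{R}^n$ onto $\mathbb{R}^n_{>0}$, and $(\nabla\mathcal{A})^{-1}$ denotes its inverse. *)

theory Defs
  imports "HOL-Analysis.Analysis"
begin

(* The componentwise product and the all-ones vector are the library's times and 1 on vectors. *)

definition vexp :: "real ^ 'n \<Rightarrow> real ^ 'n"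
  where "vexp v = (\<chi> i. exp (v $ i))"

definition vdivide :: "real ^ 'n \<Rightarrow> real ^ 'n \<Rightarrow> real ^ 'n"  (infixl \<open>\<oslash>\<close> 70)
  where "u \<oslash> v = (\<chi> i. u $ i / v $ i)"

(* The library's strict order on vectors is not the componentwise one
   (u < v there means u <= v and u ~= v), hence the explicit quantifier. *)
definition pos_orthant :: "(real ^ 'n) set"
  where "pos_orthant = {v. \<forall>i. 0 < v $ i}"

(* Meant for u >= 0 and v > 0 componentwise; 0 log 0 = 0 holds because 0 * ln 0 = 0 in HOL. *)
definition KL :: "real ^ 'm \<Rightarrow> real ^ 'm \<Rightarrow> real"
  where "KL u v = (\<Sum>i\<in>UNIV. u $ i * ln (u $ i / v $ i) + v $ i - u $ i)"

(* The gradient is unique when it exists; the value is unspecified at points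
   where f is not differentiable. *)
definition gradient :: "('a::real_inner \<Rightarrow> real) \<Rightarrow> 'a \<Rightarrow> 'a"
  where "gradient f x = (THE D. GDERIV f x :> D)"

(* The inverse is the total Hilbert-choice inverse, so the step is meaningful only if f and \<Phi>
   are differentiable, the gradient of \<Phi> is injective, and the argument is in its range. *)
definition mirror_descent_step ::
    "('a::real_inner \<Rightarrow> real) \<Rightarrow> ('a \<Rightarrow> real) \<Rightarrow> 'a \<Rightarrow> 'a"
  where "mirror_descent_step \<Phi> f \<theta> = inv (gradient \<Phi>) (gradient \<Phi> \<theta> - gradient f \<theta>)"

definition emml_objective :: "real ^ 'n ^ 'm \<Rightarrow> real ^ 'm \<Rightarrow> real ^ 'n \<Rightarrow> real"
  where "emml_objective A y \<theta> = KL y (A *v vexp \<theta>)"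

definition emml_potential :: "real ^ 'n ^ 'm \<Rightarrow> real ^ 'n \<Rightarrow> real"
  where "emml_potential A \<theta> = (\<Sum>i\<in>UNIV. \<Sum>j\<in>UNIV. A $ i $ j * exp (\<theta> $ j))"

definition emml_step :: "real ^ 'n ^ 'm \<Rightarrow> real ^ 'm \<Rightarrow> real ^ 'n \<Rightarrow> real ^ 'n"
  where "emml_step A y x = x * ((transpose A *v (y \<oslash> (A *v x))) \<oslash> (transpose A *v 1))"

end

theory Submission
  imports Defs
begin

text \<open>
  Writing \<open>x = exp \<theta>\<close> and \<open>c = A\<^sup>T 1\<close>, the chain rule gives
  \<open>\<nabla>\<A>(\<theta>) = x \<odot> c\<close> and \<open>\<nabla>g(\<theta>) = x \<odot> (c - A\<^sup>T (y / A x))\<close>. In the difference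
  the terms \<open>x \<odot> c\<close> cancel, leaving \<open>x \<odot> A\<^sup>T (y / A x)\<close>. The column assumption says that
  \<open>c\<close> is positive, so \<open>\<nabla>\<A>\<close> is inverted by \<open>v \<mapsto> log (v / c)\<close>.
\<close>

text \<open>\<open>gradient\<close> is a definite description, so a computed derivative evaluates it
  only through uniqueness: the functional \<open>h \<bullet> D\<close> of \<open>h\<close>
  determines \<open>D\<close>.\<close>

lemma gradient_eq:
  assumes "GDERIV f x :> D"
  shows "gradient f x = D"
proof -
  have "E = D" if "GDERIV f x :> E" for E
  proof -
    have "(\<lambda>h. h \<bullet> E) = (\<lambda>h. h \<bullet> D)"
      using that assms unfolding gderiv_def by (rule has_derivative_unique)
    then show ?thesis
      by (simp add: fun_eq_iff vector_eq_ldot)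
  qed
  with assms show ?thesis
    unfolding gradient_def by (rule the_equality)
qed

lemma vexp_nth [simp]: "vexp v $ i = exp (v $ i)"
  by (simp add: vexp_def)

lemma vdivide_nth [simp]: "(u \<oslash> v) $ i = u $ i / v $ i"
  by (simp add: vdivide_def)

lemmas has_derivative_vec_nth [derivative_intros] =
  bounded_linear.has_derivative[OF bounded_linear_vec_nth]

lemma has_derivative_vexp: "(vexp has_derivative (\<lambda>h. h * vexp \<theta>)) (at \<theta>)"
proof -
  have "((\<lambda>\<theta>. exp (\<theta> $ i)) has_derivative (\<lambda>h. h $ i * exp (\<theta> $ i))) (at \<theta>)" for i
    by (auto intro!: derivative_eq_intros)
  then show ?thesis
    unfolding has_derivative_componentwise_within[of vexp] Basis_vec_def
    by (auto simp: inner_axis)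
qed

text \<open>Passing to the adjoint of \<open>A\<close> and of componentwise multiplication by
  \<open>x\<close> isolates \<open>h\<close>, which turns a derivative into gradient form.\<close>

lemma inner_matrix_vector_mult_times:
  fixes A :: "real ^ 'n ^ 'm"
  shows "(A *v (h * x)) \<bullet> w = h \<bullet> (x * (transpose A *v w))"
proof -
  have "(A *v (h * x)) \<bullet> w = (h * x) \<bullet> (transpose A *v w)"
    by (metis dot_lmul_matrix inner_commute transpose_matrix_vector)
  then show ?thesis
    by (simp add: inner_vec_def mult.assoc)
qed

text \<open>Objective and potential both have the form \<open>F (A *v vexp \<theta>)\<close>, so one
  chain rule yields both gradients.\<close>

lemma GDERIV_matrix_vexp:
  fixes A :: "real ^ 'n ^ 'm"
  assumes "GDERIV F (A *v vexp \<theta>) :> w"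
  shows "GDERIV (\<lambda>\<theta>. F (A *v vexp \<theta>)) \<theta> :> vexp \<theta> * (transpose A *v w)"
proof -
  have "((\<lambda>\<theta>. A *v vexp \<theta>) has_derivative (\<lambda>h. A *v (h * vexp \<theta>))) (at \<theta>)"
    by (rule bounded_linear.has_derivative[OF matrix_vector_mul_bounded_linear has_derivative_vexp])
  from has_derivative_compose[OF this assms[unfolded gderiv_def]]
  show ?thesis
    by (simp add: gderiv_def inner_matrix_vector_mult_times)
qed

lemma GDERIV_KL:
  assumes u: "\<And>i. 0 \<le> u $ i" and v: "v \<in> pos_orthant"
  shows "GDERIV (KL u) v :> 1 - u \<oslash> v"
proof -
  have "((\<lambda>v. u $ i * ln (u $ i / v $ i) + v $ i - u $ i) has_derivative
      (\<lambda>h. h $ i * (1 - u $ i / v $ i))) (at v)" for i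
  proof -
    have "0 < v $ i"
      using v by (simp add: pos_orthant_def)
    have "((\<lambda>t. a * ln (a / t) + t - a) has_real_derivative (1 - a / t)) (at t)"
      if "0 \<le> a" "0 < t" for a t :: real
    \<comment> \<open>The derivative of \<open>ln\<close> needs a positive argument
      \<open>a / t\<close>. For \<open>a = 0\<close> the logarithmic term vanishes identically and
      the slope is 1.\<close>
    proof (cases "a = 0")
      case True
      then show ?thesis
        by (auto intro!: derivative_eq_intros)
    next
      case False
      with that have "0 < a / t"
        by simp
      then show ?thesis
        using that by (auto intro!: derivative_eq_intros)
    qed
    from DERIV_compose_FDERIV[OF this[OF u \<open>0 < v $ i\<close>] has_derivative_vec_nth[OF has_derivative_ident]]
    show ?thesis .
  qed
  then have "((\<lambda>v. \<Sum>i\<in>UNIV. u $ i * ln (u $ i / v $ i) + v $ i - u $ i) has_derivative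
      (\<lambda>h. \<Sum>i\<in>UNIV. h $ i * (1 - u $ i / v $ i))) (at v)"
    by (intro has_derivative_sum) auto
  then show ?thesis
    unfolding gderiv_def KL_def inner_vec_def by simp
qed

lemma matrix_vexp_pos:
  fixes A :: "real ^ 'n ^ 'm"
  assumes "\<And>i j. 0 \<le> A $ i $ j" and "\<And>i. \<exists>j. 0 < A $ i $ j"
  shows "A *v vexp \<theta> \<in> pos_orthant"
proof -
  have "0 < (\<Sum>j\<in>UNIV. A $ i $ j * exp (\<theta> $ j))" for i
  proof -
    obtain j where "0 < A $ i $ j"
      using assms(2) by blast
    then show ?thesis
      by (intro sum_pos2[of _ j]) (auto simp: assms(1))
  qed
  then show ?thesis
    by (simp add: pos_orthant_def matrix_vector_mult_def)
qed

lemma transpose_one_pos: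
  fixes A :: "real ^ 'n ^ 'm"
  assumes "\<And>i j. 0 \<le> A $ i $ j" and "\<And>j. \<exists>i. 0 < A $ i $ j"
  shows "transpose A *v 1 \<in> pos_orthant"
proof -
  \<comment> \<open>The rows of \<open>transpose A\<close> are the columns of \<open>A\<close>, and
    \<open>1 = vexp 0\<close>, so the row version applies at the origin.\<close>
  have "transpose A *v vexp 0 \<in> pos_orthant"
    using assms by (intro matrix_vexp_pos) (auto simp: transpose_def)
  moreover have "vexp 0 = (1 :: real ^ 'm)"
    by (simp add: vec_eq_iff)
  ultimately show ?thesis
    by simp
qed

text \<open>A positive sum must contain a positive term, and dividing that term by a positive number
  keeps it positive. Entries of \<open>u\<close> may therefore be zero.\<close>

lemma matrix_vdivide_pos:
  fixes B :: "real ^ 'm ^ 'n"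
  assumes B: "\<And>j i. 0 \<le> B $ j $ i" and u: "\<And>i. 0 \<le> u $ i"
    and v: "v \<in> pos_orthant" and Bu: "B *v u \<in> pos_orthant"
  shows "B *v (u \<oslash> v) \<in> pos_orthant"
proof -
  have v': "0 < v $ i" for i
    using v by (simp add: pos_orthant_def)
  have "0 < (\<Sum>i\<in>UNIV. B $ j $ i * (u $ i / v $ i))" for j
  proof -
    have "0 < (\<Sum>i\<in>UNIV. B $ j $ i * u $ i)"
      using Bu by (simp add: pos_orthant_def matrix_vector_mult_def)
    then obtain i where "0 < B $ j $ i * u $ i"
      by (meson not_less sum_nonpos)
    then have "0 < B $ j $ i * (u $ i / v $ i)"
      using v'[of i] by simp
    then show ?thesis
      using v' by (intro sum_pos2[of _ i]) (auto simp: B u less_imp_le)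
  qed
  then show ?thesis
    by (simp add: pos_orthant_def matrix_vector_mult_def)
qed

lemma bij_betw_vexp_times:
  assumes "c \<in> pos_orthant"
  shows "bij_betw (\<lambda>\<theta>. vexp \<theta> * c) UNIV pos_orthant"
proof -
  have c: "0 < c $ j" for j
    using assms by (simp add: pos_orthant_def)
  then have c0: "c $ j \<noteq> 0" for j
    by (metis less_irrefl)
  show ?thesis
    by (rule bij_betw_byWitness[where f' = "\<lambda>v. \<chi> j. ln (v $ j / c $ j)"])
      (use c c0 in \<open>auto simp: pos_orthant_def vec_eq_iff\<close>)
qed

lemma GDERIV_emml_objective:
  assumes "\<And>i. 0 \<le> y $ i" and "A *v vexp \<theta> \<in> pos_orthant"
  shows "GDERIV (emml_objective A y) \<theta> :>
    vexp \<theta> * (transpose A *v (1 - y \<oslash> (A *v vexp \<theta>)))"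
  unfolding emml_objective_def by (rule GDERIV_matrix_vexp[OF GDERIV_KL[OF assms]])

lemma GDERIV_emml_potential:
  "GDERIV (emml_potential A) \<theta> :> vexp \<theta> * (transpose A *v 1)"
proof -
  \<comment> \<open>The outer function of the potential is the sum of entries, which is linear with
    constant gradient \<open>1\<close>.\<close>
  have "GDERIV (\<lambda>v. v \<bullet> 1) v :> 1" for v :: "real ^ 'm"
    unfolding gderiv_def by (auto intro!: derivative_eq_intros)
  from GDERIV_matrix_vexp[OF this, of A \<theta>] show ?thesis
    by (simp add: emml_potential_def[abs_def] inner_vec_def matrix_vector_mult_def)
qed

theorem proposition7:
  fixes A :: "real ^ 'n ^ 'm" and y :: "real ^ 'm"
  assumes A_nonneg: "\<And>i j. 0 \<le> A $ i $ j"
    and y_nonneg: "\<And>i. 0 \<le> y $ i"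
    and rows: "\<And>i. \<exists>j. 0 < A $ i $ j"
    and cols: "\<And>j. \<exists>i. 0 < A $ i $ j"
    and ATy_pos: "transpose A *v y \<in> pos_orthant"
  defines "g \<equiv> emml_objective A y"
    and "\<Phi> \<equiv> emml_potential A"
  shows "bij_betw (gradient \<Phi>) UNIV pos_orthant
    \<and> (\<forall>\<theta>. A *v vexp \<theta> \<in> pos_orthant
        \<and> (\<exists>D. GDERIV g \<theta> :> D) \<and> (\<exists>D. GDERIV \<Phi> \<theta> :> D)
        \<and> gradient \<Phi> \<theta> - gradient g \<theta> \<in> pos_orthant)
    \<and> (\<forall>\<theta> :: nat \<Rightarrow> real ^ 'n.
        (\<forall>r. \<theta> (Suc r) = mirror_descent_step \<Phi> g (\<theta> r))
        \<longleftrightarrow> (\<forall>r. vexp (\<theta> (Suc r)) = emml_step A y (vexp (\<theta> r))))"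
proof -
  define c where "c = transpose A *v (1 :: real ^ 'm)"
  define z where "z \<theta> = transpose A *v (y \<oslash> (A *v vexp \<theta>))" for \<theta>
  have Ax: "A *v vexp \<theta> \<in> pos_orthant" for \<theta>
    using A_nonneg rows by (rule matrix_vexp_pos)
  have c_pos: "c \<in> pos_orthant"
    unfolding c_def using A_nonneg cols by (rule transpose_one_pos)
  \<comment> \<open>Here \<open>ATy_pos\<close> enters: positivity of \<open>z \<theta>\<close> puts
    the argument of the inverse into the range of \<open>gradient \<Phi>\<close>.\<close>
  have z_pos: "z \<theta> \<in> pos_orthant" for \<theta>
    unfolding z_def using y_nonneg Ax ATy_pos
    by (intro matrix_vdivide_pos) (auto simp: transpose_def A_nonneg)
  have derivs: "GDERIV \<Phi> \<theta> :> vexp \<theta> * c" "GDERIV g \<theta> :> vexp \<theta> * (c - z \<theta>)" for \<theta>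
    using GDERIV_emml_potential[of A \<theta>] GDERIV_emml_objective[OF y_nonneg Ax, of \<theta>]
    by (simp_all add: \<Phi>_def g_def c_def z_def matrix_vector_mult_diff_distrib)
  have grad: "gradient \<Phi> = (\<lambda>\<theta>. vexp \<theta> * c)"
    using gradient_eq[OF derivs(1)] by blast
  have bij: "bij_betw (gradient \<Phi>) UNIV pos_orthant"
    unfolding grad using c_pos by (rule bij_betw_vexp_times)
  have diff: "gradient \<Phi> \<theta> - gradient g \<theta> = vexp \<theta> * z \<theta>" for \<theta>
    using gradient_eq[OF derivs(2)] by (simp add: grad algebra_simps)
  have diff_pos: "gradient \<Phi> \<theta> - gradient g \<theta> \<in> pos_orthant" for \<theta>
    using z_pos[of \<theta>] unfolding diff by (simp add: pos_orthant_def)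
  \<comment> \<open>It suffices to compare a single step between arbitrary points; the claim on
    sequences is this equivalence at every \<open>r\<close>.\<close>
  have "\<theta>' = mirror_descent_step \<Phi> g \<theta> \<longleftrightarrow> vexp \<theta>' = emml_step A y (vexp \<theta>)" for \<theta> \<theta>'
  proof -
    \<comment> \<open>The choice-based \<open>inv\<close> is a genuine inverse here:
      \<open>diff_pos\<close> and surjectivity onto \<open>pos_orthant\<close> give a preimage, and
      injectivity makes it unique.\<close>
    have "\<theta>' = mirror_descent_step \<Phi> g \<theta> \<longleftrightarrow> gradient \<Phi> \<theta>' = vexp \<theta> * z \<theta>"
      using bij diff_pos[of \<theta>] unfolding mirror_descent_step_def diff
      by (metis bij_betw_imp_inj_on bij_betw_imp_surj_on f_inv_into_f inv_f_f)
    also have "\<dots> \<longleftrightarrow> vexp \<theta>' = vexp \<theta> * (z \<theta> \<oslash> c)"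
    proof -
      have "c $ j \<noteq> 0" for j
        using c_pos by (auto simp: pos_orthant_def dest: spec[of _ j])
      then show ?thesis
        by (simp add: grad vec_eq_iff eq_divide_eq)
    qed
    finally show ?thesis
      by (simp add: emml_step_def z_def c_def)
  qed
  with bij Ax derivs diff_pos show ?thesis
    by blast
qed

end
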